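(* Let $n,k$ be integers with $2 \le k \le n/2$. Suppose $\mathcal{F}^* \subseteq \mathcal{F} \subseteq \binom{[n]}{k}$ have the property that for any $B, B' \in \mathcal{F}$ with $B \cap B' = \emptyset$ we have $B, B' \in \mathcal{F}^*$. Then $$|\mathcal{F}^*| + \frac{n}{k}\,|\mathcal{F} \setminus \mathcal{F}^*| \le \binom{n}{k}.$$ Moreover, if $n > 2k$, equality holds only if $\mathcal{F}^* = \mathcal{F} = \binom{[n]}{k}$, or if $\mathcal{F}^* = \emptyset$ and $\mathcal{F}$ is a star of maximum size, i.e. $\mathcal{F} = \{B \in \binom{[n]}{k} : x \in B\}$ for some $x \in [n]$.
   Context: $[n] = \{1,\dots,n\}$ and $\binom{X}{k}$ denotes the set of $k$-element subsets of $X$. *)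

theory Defs
  imports Complex_Main "HOL-Library.Ramsey"
begin

end

theory Submission
  imports Defs "HOL-Combinatorics.Multiset_Permutations"
begin

text \<open>
  Katona's cycle method. Give sets in \<open>\<F>s\<close> weight \<open>1\<close> and sets in \<open>\<F> - \<F>s\<close> weight \<open>n / k\<close>. In a
  cyclic order of the ground set, an arc of length \<open>k\<close> in \<open>\<F> - \<F>s\<close> meets \<open>2 * k - 2\<close> other arcs,
  which form \<open>k - 1\<close> pairs of disjoint arcs of weight at most \<open>n / k\<close>, and all remaining arcs have
  weight \<open>0\<close>; hence each cyclic order has total weight at most \<open>n\<close>, and averaging gives the bound.
  In the extremal case with \<open>n > 2 * k\<close> every cyclic order is tight, so its arcs either all lie in
  \<open>\<F>s\<close> or all avoid \<open>\<F>s\<close>. As any two \<open>k\<close>-sets are arcs of a common cyclic order, a nonempty \<open>\<F>s\<close>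
  contains everything. If \<open>\<F>s\<close> is empty, the arcs in \<open>\<F>\<close> of a cyclic order are the \<open>k\<close> arcs through
  one point \<open>x\<close>; rearranging the order around \<open>x\<close> shows that \<open>\<F>\<close> contains every \<open>k\<close>-set
  through \<open>x\<close> that avoids one fixed element, which forces \<open>\<F>\<close> into the star of \<open>x\<close>.
\<close>

section \<open>Averaging over all orderings of a finite set\<close>

text \<open>A bijection of \<open>V\<close> carrying \<open>B\<close> to \<open>B'\<close>, glued
  from bijections between the two sets and between their complements, acts injectively on orderings.
  Exchanging \<open>B\<close> and \<open>B'\<close> turns the bound into equality.\<close>

lemma card_permutations_take_eq_le:
  assumes "finite V" "B \<in> nsets V k" "B' \<in> nsets V k"
  shows "card {xs \<in> permutations_of_set V. set (take k xs) = B}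
    \<le> card {xs \<in> permutations_of_set V. set (take k xs) = B'}"
proof -
  have B: "B \<subseteq> V" "finite B" "card B = k" and B': "B' \<subseteq> V" "finite B'" "card B' = k"
    using assms by (auto simp: nsets_def)
  obtain f where f: "bij_betw f B B'"
    using B B' by (metis finite_same_card_bij)
  have "card (V - B) = card (V - B')"
    using B B' by (simp add: card_Diff_subset)
  then obtain g where g: "bij_betw g (V - B) (V - B')"
    using assms(1) by (metis finite_Diff finite_same_card_bij)
  define h where "h = (\<lambda>x. if x \<in> B then f x else g x)"
  have hB: "bij_betw h B B'"
    using f by (rule bij_betw_cong[THEN iffD1, rotated]) (simp add: h_def)
  moreover have "bij_betw h (V - B) (V - B')"
    using g by (rule bij_betw_cong[THEN iffD1, rotated]) (simp add: h_def)
  ultimately have "bij_betw h (B \<union> (V - B)) (B' \<union> (V - B'))"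
    by (rule bij_betw_combine) auto
  moreover have "B \<union> (V - B) = V" "B' \<union> (V - B') = V"
    using B B' by auto
  ultimately have h: "inj_on h V" "h ` V = V"
    by (auto simp: bij_betw_def)
  show ?thesis
  proof (rule card_inj_on_le[where f = "map h"])
    show "inj_on (map h) {xs \<in> permutations_of_set V. set (take k xs) = B}"
    proof (rule inj_onI)
      fix xs ys
      assume "xs \<in> {xs \<in> permutations_of_set V. set (take k xs) = B}"
        "ys \<in> {xs \<in> permutations_of_set V. set (take k xs) = B}" and eq: "map h xs = map h ys"
      then have "set xs \<union> set ys = V"
        by (auto simp: permutations_of_set_def)
      then show "xs = ys"
        using map_inj_on[OF eq] h(1) by simp
    qed
    show "map h ` {xs \<in> permutations_of_set V. set (take k xs) = B}
      \<subseteq> {xs \<in> permutations_of_set V. set (take k xs) = B'}"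
      using h hB by (auto simp: permutations_of_set_def distinct_map take_map bij_betw_def)
  qed (use assms(1) in auto)
qed

lemma set_take_in_nsets:
  assumes "xs \<in> permutations_of_set V" "k \<le> card V"
  shows "set (take k xs) \<in> nsets V k"
proof -
  have "set xs = V" "distinct xs" "length xs = card V"
    using assms by (auto simp: permutations_of_set_def distinct_card)
  then show ?thesis
    using assms(2) set_take_subset[of k xs] by (auto simp: nsets_def distinct_card)
qed

lemma sum_permutations_take:
  fixes w :: "'a set \<Rightarrow> real"
  assumes "finite V" "k \<le> card V"
  shows "(\<Sum>xs\<in>permutations_of_set V. w (set (take k xs))) * real (card V choose k)
    = fact (card V) * (\<Sum>B\<in>nsets V k. w B)"
proof -
  define c where "c = (\<lambda>B. card {xs \<in> permutations_of_set V. set (take k xs) = B})"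
  have finN: "finite (nsets V k)"
    using assms(1) by (rule finite_imp_finite_nsets)
  have "nsets V k \<noteq> {}"
    using assms by (metis leD nsets_eq_empty_iff)
  then obtain B0 where B0: "B0 \<in> nsets V k"
    by blast
  have c: "c B = c B0" if "B \<in> nsets V k" for B
    unfolding c_def using assms(1) B0 that by (intro antisym card_permutations_take_eq_le) auto
  have sum_eq: "(\<Sum>xs\<in>permutations_of_set V. w (set (take k xs))) = c B0 * (\<Sum>B\<in>nsets V k. w B)"
    for w :: "'a set \<Rightarrow> real"
  proof -
    have "(\<Sum>xs\<in>permutations_of_set V. w (set (take k xs)))
      = (\<Sum>B\<in>nsets V k. \<Sum>xs | xs \<in> permutations_of_set V \<and> set (take k xs) = B. w (set (take k xs)))"
      using finN assms(2) by (intro sum.group[symmetric]) (auto intro: set_take_in_nsets)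
    also have "\<dots> = (\<Sum>B\<in>nsets V k. c B * w B)"
      by (simp add: c_def)
    also have "\<dots> = c B0 * (\<Sum>B\<in>nsets V k. w B)"
      using c by (simp add: sum_distrib_left)
    finally show ?thesis .
  qed
  \<comment> \<open>The constant weight 1 determines the common count \<open>c B0\<close>, so it
    need not be computed from factorials.\<close>
  from sum_eq[of "\<lambda>_. 1"] have "fact (card V) = c B0 * real (card V choose k)"
    using assms(1) by simp
  then show ?thesis
    using sum_eq[of w] by (simp add: mult_ac)
qed

lemma sum_permutations_rotate:
  assumes "finite V"
  shows "(\<Sum>xs\<in>permutations_of_set V. f (rotate i xs)) = (\<Sum>xs\<in>permutations_of_set V. f xs)"
proof (rule sum.reindex_bij_betw)
  have "inj (rotate i)"
    unfolding rotate_def by (rule inj_fn[OF inj_rotate1])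
  then have inj: "inj_on (rotate i) (permutations_of_set V)"
    by (rule inj_on_subset) simp
  moreover have "rotate i ` permutations_of_set V \<subseteq> permutations_of_set V"
    by (auto simp: permutations_of_set_def)
  ultimately show "bij_betw (rotate i) (permutations_of_set V) (permutations_of_set V)"
    by (simp add: bij_betw_def endo_inj_surj)
qed

lemma sum_periodic_shift:
  fixes g :: "nat \<Rightarrow> 'a::ab_group_add"
  assumes "\<And>i. g (i + n) = g i"
  shows "(\<Sum>i<n. g (i + m)) = (\<Sum>i<n. g i)"
proof (induction m)
  case (Suc m)
  have "(\<Sum>i<n. g (Suc i + m)) = (\<Sum>i<Suc n. g (i + m)) - g m"
    by (simp only: sum.lessThan_Suc_shift) simp
  also have "\<dots> = (\<Sum>i<n. g (i + m))"
    using assms[of m] by (simp add: add.commute)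
  finally show ?case
    using Suc by simp
qed simp

section \<open>Arcs of a cyclic order and their weights\<close>

text \<open>The families stay parameters so that the weighted bound can be applied a second time, to
  a full star with \<open>{}\<close> in place of \<open>\<F>s\<close>.\<close>

locale disjointness_closed =
  fixes V :: "'a set" and k :: nat and \<F> \<F>s :: "'a set set"
  assumes finV: "finite V" and k_pos: "1 \<le> k" and k_le: "2 * k \<le> card V"
    and Fs_sub: "\<F>s \<subseteq> \<F>" and F_sub: "\<F> \<subseteq> nsets V k"
    and disj: "\<And>B B'. B \<in> \<F> \<Longrightarrow> B' \<in> \<F> \<Longrightarrow> B \<inter> B' = {} \<Longrightarrow> B \<in> \<F>s \<and> B' \<in> \<F>s"
begin

definition ratio :: real where "ratio = real (card V) / real k"

definition wt :: "'a set \<Rightarrow> real" where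
  "wt B = (if B \<in> \<F>s then 1 else if B \<in> \<F> then ratio else 0)"

text \<open>The start \<open>i\<close> is not reduced modulo \<open>card V\<close>:
  \<open>rotate\<close> wraps around by itself, so shifting an arc is plain addition.\<close>

definition arc :: "'a list \<Rightarrow> nat \<Rightarrow> 'a set" where
  "arc xs i = set (take k (rotate i xs))"

definition cycle_wt :: "'a list \<Rightarrow> real" where
  "cycle_wt xs = (\<Sum>i<card V. wt (arc xs i))"

lemma ratio_ge: "2 \<le> ratio"
  using k_pos k_le by (simp add: ratio_def field_simps)

lemma ratio_gt: "2 < ratio" if "2 * k < card V"
  using k_pos that by (simp add: ratio_def field_simps)

lemma k_ratio: "real k * ratio = real (card V)"
  using k_pos by (simp add: ratio_def)

lemma sum_ratio: "(\<Sum>i\<in>{1..<k}. ratio) = real (card V) - ratio"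
  using k_pos by (simp add: left_diff_distrib k_ratio)

text \<open>If both sets lie in \<open>\<F>\<close>, both lie in \<open>\<F>s\<close> and weigh 2,
  at most \<open>ratio\<close>; otherwise one of them weighs 0.\<close>

lemma wt_disjoint_le: "wt B + wt B' \<le> ratio" if "B \<inter> B' = {}"
  using that disj[of B B'] Fs_sub ratio_ge by (auto simp: wt_def)

text \<open>As \<open>ratio\<close> exceeds 2, the sums 1 and 2 that involve a set of
  \<open>\<F>s\<close> are too small; what remains is \<open>ratio + 0\<close>.\<close>

lemma wt_disjoint_eq:
  assumes "2 * k < card V" "B \<inter> B' = {}" "wt B + wt B' = ratio"
  shows "B \<notin> \<F>s" "B' \<notin> \<F>s" "B \<in> \<F> \<longleftrightarrow> B' \<notin> \<F>"
  using assms(2,3) disj[of B B'] Fs_sub ratio_gt[OF assms(1)] by (auto simp: wt_def split: if_splits)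

lemma wt_disjoint_zero: "wt B' = 0" if "B \<in> \<F> - \<F>s" "B \<inter> B' = {}"
  using that disj[of B B'] Fs_sub by (auto simp: wt_def)

definition enum :: "'a set \<Rightarrow> 'a list" where
  "enum S = (SOME xs. set xs = S \<and> distinct xs)"

lemma enum: "set (enum S) = S" "distinct (enum S)" if "S \<subseteq> V"
proof -
  have "\<exists>xs. set xs = S \<and> distinct xs"
    using finite_distinct_list[OF finite_subset[OF that finV]] .
  then have "set (enum S) = S \<and> distinct (enum S)"
    unfolding enum_def by (rule someI_ex)
  then show "set (enum S) = S" "distinct (enum S)"
    by auto
qed

lemma length_perm: "length xs = card V" if "xs \<in> permutations_of_set V"
  using that by (auto simp: permutations_of_set_def distinct_card)

lemma rotate_perm: "rotate i xs \<in> permutations_of_set V" if "xs \<in> permutations_of_set V"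
  using that by (simp add: permutations_of_set_def)

lemma arc_rotate: "arc (rotate j xs) i = arc xs (i + j)"
  by (simp add: arc_def rotate_rotate)

lemma arc_periodic: "arc xs (i + card V) = arc xs i" if "xs \<in> permutations_of_set V"
  using that by (simp add: arc_def length_perm flip: rotate_rotate)

lemma arc_mod: "arc xs i = arc xs (i mod card V)" if "xs \<in> permutations_of_set V"
  unfolding arc_def using rotate_conv_mod[of i xs] length_perm[OF that] by simp

text \<open>After rotating the first arc to the front, the second one starts at or after its end and
  stops before wrapping around.\<close>

lemma arc_disjoint:
  assumes xs: "xs \<in> permutations_of_set V" and m: "k \<le> m" "m + k \<le> card V"
  shows "arc xs i \<inter> arc xs (i + m) = {}"
proof -
  define ys where "ys = rotate i xs"
  have ys: "distinct ys" "length ys = card V"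
    using xs by (auto simp: ys_def length_perm permutations_of_set_def)
  have "m < card V"
    using m k_pos by simp
  then have "take k (rotate m ys) = take k (drop m ys)"
    using m ys by (simp add: rotate_drop_take)
  then have "set (take k (rotate m ys)) \<subseteq> set (drop m ys)"
    by (simp add: set_take_subset)
  moreover have "set (take k ys) \<inter> set (drop m ys) = {}"
    using ys m by (simp add: set_take_disj_set_drop_if_distinct)
  ultimately show ?thesis
    by (auto simp: arc_def ys_def rotate_rotate add.commute)
qed

lemma cycle_wt_rotate: "cycle_wt (rotate j xs) = cycle_wt xs" if "xs \<in> permutations_of_set V"
  using sum_periodic_shift[of "\<lambda>i. wt (arc xs i)" "card V" j] that
  by (simp add: cycle_wt_def arc_rotate arc_periodic)

lemma arc_pair_disjoint:
  assumes "xs \<in> permutations_of_set V"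
  shows "arc xs i \<inter> arc xs (i + (card V - k)) = {}"
  using assms k_le by (intro arc_disjoint) auto

section \<open>The weight of a single cyclic order\<close>

lemma cycle_wt_pairs:
  assumes xs: "xs \<in> permutations_of_set V" and "arc xs 0 \<in> \<F> - \<F>s"
  shows "cycle_wt xs = ratio + (\<Sum>i\<in>{1..<k}. wt (arc xs i) + wt (arc xs (i + (card V - k))))"
proof -
  let ?g = "\<lambda>i. wt (arc xs i)" and ?n = "card V"
  have zero: "?g i = 0" if "k \<le> i" "i \<le> ?n - k" for i
    using arc_disjoint[OF xs, of i 0] that assms(2) k_le wt_disjoint_zero by auto
  have "cycle_wt xs = sum ?g {0..<?n}"
    by (simp add: cycle_wt_def atLeast0LessThan)
  \<comment> \<open>The blocks are arc 0 itself, the arcs starting inside it, those disjoint from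
    it, and those running into it from behind. The second and fourth have \<open>k - 1\<close> arcs
    each and are matched by the shift \<open>card V - k\<close>.\<close>
  also have "\<dots> = sum ?g {0..<1} + (sum ?g {1..<k} + (sum ?g {k..<?n - k + 1} + sum ?g {?n - k + 1..<?n}))"
    using k_pos k_le by (simp add: sum.atLeastLessThan_concat del: sum.op_ivl_Suc One_nat_def)
  also have "sum ?g {k..<?n - k + 1} = 0"
    using zero by (intro sum.neutral) auto
  also have "sum ?g {?n - k + 1..<?n} = (\<Sum>i\<in>{1..<k}. ?g (i + (?n - k)))"
    using sum.shift_bounds_nat_ivl[of ?g 1 "?n - k" k] k_le by (simp add: add.commute)
  also have "sum ?g {0..<1} = ratio"
    using assms(2) by (simp add: wt_def)
  finally show ?thesis
    by (simp add: sum.distrib)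
qed

lemma cycle_wt_le_if_first_marked:
  assumes xs: "xs \<in> permutations_of_set V" and "arc xs 0 \<in> \<F> - \<F>s"
  shows "cycle_wt xs \<le> real (card V)"
proof -
  have "(\<Sum>i\<in>{1..<k}. wt (arc xs i) + wt (arc xs (i + (card V - k)))) \<le> (\<Sum>i\<in>{1..<k}. ratio)"
    using arc_pair_disjoint[OF xs] by (intro sum_mono wt_disjoint_le) auto
  then show ?thesis
    unfolding cycle_wt_pairs[OF assms] sum_ratio by linarith
qed

lemma cycle_wt_le:
  assumes xs: "xs \<in> permutations_of_set V"
  shows "cycle_wt xs \<le> real (card V)"
proof (cases "\<exists>i. arc xs i \<in> \<F> - \<F>s")
  case True
  then obtain i where "arc (rotate i xs) 0 \<in> \<F> - \<F>s"
    by (auto simp: arc_rotate)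
  from cycle_wt_le_if_first_marked[OF rotate_perm[OF xs] this] show ?thesis
    by (simp only: cycle_wt_rotate[OF xs])
next
  case False
  then have "wt (arc xs i) \<le> 1" for i
    by (auto simp: wt_def)
  then have "cycle_wt xs \<le> (\<Sum>i<card V. 1)"
    unfolding cycle_wt_def by (intro sum_mono) auto
  then show ?thesis
    by simp
qed

section \<open>Cyclic orders of maximal weight\<close>

lemma tight_no_marked:
  assumes "xs \<in> permutations_of_set V" "cycle_wt xs = real (card V)"
    and "\<And>i. arc xs i \<notin> \<F> - \<F>s"
  shows "arc xs i \<in> \<F>s"
proof -
  have le: "wt (arc xs i) \<le> 1" for i
    using assms(3) by (auto simp: wt_def)
  have "card V > 0"
    using k_pos k_le by linarith
  then have "wt (arc xs (i mod card V)) = 1"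
    using sum_mono_inv[of "\<lambda>i. wt (arc xs i)" "{..<card V}" "\<lambda>_. 1" "i mod card V"] le assms(2)
    by (simp add: cycle_wt_def)
  then show ?thesis
    using assms(3)[of i] arc_mod[OF assms(1), of i] by (auto simp: wt_def split: if_splits)
qed

lemma tight_pair:
  assumes xs: "xs \<in> permutations_of_set V" "cycle_wt xs = real (card V)"
    and "arc xs 0 \<in> \<F> - \<F>s" "i \<in> {1..<k}"
  shows "wt (arc xs i) + wt (arc xs (i + (card V - k))) = ratio"
proof (rule sum_mono_inv[where f = "\<lambda>i. wt (arc xs i) + wt (arc xs (i + (card V - k)))"
      and g = "\<lambda>_. ratio" and I = "{1..<k}"])
  show "(\<Sum>i\<in>{1..<k}. wt (arc xs i) + wt (arc xs (i + (card V - k)))) = (\<Sum>i\<in>{1..<k}. ratio)"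
    using cycle_wt_pairs[OF xs(1) assms(3)] xs(2) unfolding sum_ratio by linarith
  show "wt (arc xs i) + wt (arc xs (i + (card V - k))) \<le> ratio" for i
    using arc_pair_disjoint[OF xs(1)] by (intro wt_disjoint_le) auto
qed (use assms(4) in simp_all)

lemma tight_marked:
  assumes big: "2 * k < card V"
    and xs: "xs \<in> permutations_of_set V" "cycle_wt xs = real (card V)"
    and marked: "arc xs 0 \<in> \<F> - \<F>s" and "i < card V"
  shows "arc xs i \<notin> \<F>s"
proof -
  have pair: "arc xs j \<notin> \<F>s \<and> arc xs (j + (card V - k)) \<notin> \<F>s" if "j \<in> {1..<k}" for j
    using wt_disjoint_eq(1,2)[OF big arc_pair_disjoint[OF xs(1)] tight_pair[OF xs marked that]] by simp
  \<comment> \<open>The same four blocks: arc 0, first members of pairs, arcs disjoint from arc 0,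
    second members of pairs.\<close>
  have "i = 0 \<or> (1 \<le> i \<and> i < k) \<or> (k \<le> i \<and> i + k \<le> card V) \<or> card V < i + k"
    by linarith
  then consider "i = 0" | "1 \<le> i" "i < k" | "k \<le> i" "i + k \<le> card V" | "card V < i + k"
    by blast
  then show ?thesis
  proof cases
    case 2
    then show ?thesis
      using pair[of i] by simp
  next
    case 3
    then have "arc xs 0 \<inter> arc xs i = {}"
      using arc_disjoint[OF xs(1), of i 0] by simp
    then show ?thesis
      using marked disj[of "arc xs 0" "arc xs i"] Fs_sub by blast
  next
    case 4
    then have "i - (card V - k) \<in> {1..<k}" "i - (card V - k) + (card V - k) = i"
      using assms(5) k_le by (simp_all, arith)
    then show ?thesis
      using pair by metis
  qed (use marked in simp)
qed

section \<open>Double counting and the weighted bound\<close>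

text \<open>Rotation permutes the orderings, so each of the \<open>card V\<close> starting positions
  contributes as much as the initial one.\<close>

lemma sum_cycle_wt:
  "(\<Sum>xs\<in>permutations_of_set V. cycle_wt xs) * real (card V choose k)
    = real (card V) * fact (card V) * (\<Sum>B\<in>nsets V k. wt B)"
proof -
  have "(\<Sum>xs\<in>permutations_of_set V. cycle_wt xs)
    = (\<Sum>i<card V. \<Sum>xs\<in>permutations_of_set V. wt (set (take k (rotate i xs))))"
    unfolding cycle_wt_def arc_def by (rule sum.swap)
  also have "\<dots> = real (card V) * (\<Sum>xs\<in>permutations_of_set V. wt (set (take k xs)))"
    using sum_permutations_rotate[OF finV, of "\<lambda>xs. wt (set (take k xs))"] by simp
  finally show ?thesis
    using sum_permutations_take[OF finV, of k wt] k_le by (simp add: mult.assoc)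
qed

lemma sum_wt: "(\<Sum>B\<in>nsets V k. wt B) = real (card \<F>s) + ratio * real (card (\<F> - \<F>s))"
proof -
  have fin: "finite (nsets V k)"
    using finV by (rule finite_imp_finite_nsets)
  have "(\<Sum>B\<in>nsets V k. wt B) = (\<Sum>B\<in>\<F>s \<union> (\<F> - \<F>s). wt B)"
    using fin F_sub Fs_sub by (intro sum.mono_neutral_right) (auto simp: wt_def)
  also have "\<dots> = (\<Sum>B\<in>\<F>s. wt B) + (\<Sum>B\<in>\<F> - \<F>s. wt B)"
    using fin F_sub Fs_sub by (intro sum.union_disjoint) (auto intro: finite_subset)
  finally show ?thesis
    by (simp add: wt_def)
qed

lemma sum_cycle_wt_le: "(\<Sum>xs\<in>permutations_of_set V. cycle_wt xs) \<le> real (card V) * fact (card V)"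
proof -
  have "(\<Sum>xs\<in>permutations_of_set V. cycle_wt xs) \<le> (\<Sum>xs\<in>permutations_of_set V. real (card V))"
    by (intro sum_mono cycle_wt_le)
  then show ?thesis
    using finV by (simp add: mult.commute)
qed

lemma choose_pos: "0 < real (card V choose k)"
  using k_le by (simp add: zero_less_binomial_iff)

lemma card_V_pos: "0 < card V"
  using k_pos k_le by linarith

lemma weighted_bound: "real (card \<F>s) + ratio * real (card (\<F> - \<F>s)) \<le> real (card V choose k)"
proof -
  have "real (card V) * fact (card V) * (\<Sum>B\<in>nsets V k. wt B)
    \<le> real (card V) * fact (card V) * real (card V choose k)"
    using mult_right_mono[OF sum_cycle_wt_le, of "real (card V choose k)"] sum_cycle_wt by simp
  then show ?thesis
    using card_V_pos by (simp add: sum_wt)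
qed

end

section \<open>The case of equality\<close>

locale extremal_family = disjointness_closed +
  assumes big: "2 * k < card V"
    and extremal: "real (card \<F>s) + ratio * real (card (\<F> - \<F>s)) = real (card V choose k)"
begin

lemma tight: "cycle_wt xs = real (card V)" if xs: "xs \<in> permutations_of_set V"
proof (rule sum_mono_inv[OF _ cycle_wt_le xs])
  show "(\<Sum>xs\<in>permutations_of_set V. cycle_wt xs) = (\<Sum>xs\<in>permutations_of_set V. real (card V))"
    using sum_cycle_wt choose_pos finV extremal by (simp add: sum_wt mult.commute)
qed simp_all

lemma marked_cycle: "arc xs j \<notin> \<F>s"
  if xs: "xs \<in> permutations_of_set V" and "arc xs i \<in> \<F> - \<F>s"
proof -
  define ys where "ys = rotate i xs"
  have ys: "ys \<in> permutations_of_set V"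
    using xs by (simp add: ys_def rotate_perm)
  have marked: "arc ys 0 \<in> \<F> - \<F>s"
    using that(2) by (simp add: ys_def arc_rotate)
  \<comment> \<open>This is \<open>j - i\<close> modulo \<open>card V\<close>, written so that
    natural subtraction does not truncate.\<close>
  define m where "m = (j + (card V - i mod card V)) mod card V"
  have "(m + i) mod card V = j mod card V"
  proof -
    have "(m + i) mod card V = (j + (card V - i mod card V) + i mod card V) mod card V"
      unfolding m_def by (metis mod_add_left_eq mod_add_right_eq)
    also have "j + (card V - i mod card V) + i mod card V = j + card V"
      using mod_less_divisor[OF card_V_pos, of i] by linarith
    finally show ?thesis by simp
  qed
  then have "arc ys m = arc xs j"
    using arc_mod[OF xs, of "m + i"] arc_mod[OF xs, of j] by (simp only: ys_def arc_rotate)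
  moreover have "m < card V"
    using card_V_pos by (simp add: m_def)
  ultimately show ?thesis
    using tight_marked[OF big ys tight[OF ys] marked, of m] by simp
qed

text \<open>An ordering that begins with \<open>B - A\<close>, \<open>B \<inter> A\<close>,
  \<open>A - B\<close> has both sets as arcs. Since \<open>B\<close> is in \<open>\<F>s\<close>, no
  arc there is in \<open>\<F> - \<F>s\<close>, and tightness puts every arc into
  \<open>\<F>s\<close>.\<close>

lemma Fs_nonempty_imp_all:
  assumes "\<F>s \<noteq> {}"
  shows "nsets V k \<subseteq> \<F>s"
proof
  fix A assume A: "A \<in> nsets V k"
  obtain B where B: "B \<in> \<F>s"
    using assms by blast
  have AB: "A \<subseteq> V" "finite A" "card A = k" "B \<subseteq> V" "finite B" "card B = k"
    using A B F_sub Fs_sub by (auto simp: nsets_def)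
  define b m a r where "b = enum (B - A)" "m = enum (B \<inter> A)" "a = enum (A - B)" "r = enum (V - A - B)"
  then have l: "set b = B - A" "set m = B \<inter> A" "set a = A - B" "set r = V - A - B"
    "distinct b" "distinct m" "distinct a" "distinct r"
    using AB by (simp_all add: enum subset_iff)
  define xs where "xs = b @ m @ a @ r"
  have xs: "xs \<in> permutations_of_set V"
    using l AB by (auto simp: xs_def permutations_of_set_def)
  have s: "set (b @ m) = B" "set (m @ a) = A" and "distinct (b @ m)" "distinct (m @ a)"
    using l by auto
  then have len: "length (b @ m) = k" "length (m @ a) = k"
    using AB by (metis distinct_card)+
  have "take k xs = b @ m"
    using len by (simp add: xs_def)
  then have arcB: "arc xs 0 = B"
    using s by (simp add: arc_def)
  have "rotate (length b) xs = m @ a @ r @ b"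
    using rotate_append[of b "m @ a @ r"] by (simp add: xs_def)
  then have "take k (rotate (length b) xs) = m @ a"
    using len by simp
  then have arcA: "arc xs (length b) = A"
    using s by (simp add: arc_def)
  have "arc xs i \<notin> \<F> - \<F>s" for i
    using marked_cycle[OF xs, of i 0] arcB B by auto
  then show "A \<in> \<F>s"
    using tight_no_marked[OF xs tight[OF xs], of "length b"] arcA by simp
qed

section \<open>Equality with \<open>\<F>s\<close> empty: recovering the star\<close>

context
  assumes Fs_empty: "\<F>s = {}"
begin

lemma pair_iff:
  assumes "xs \<in> permutations_of_set V" "arc xs 0 \<in> \<F>" "i \<in> {1..<k}"
  shows "arc xs i \<in> \<F> \<longleftrightarrow> arc xs (i + (card V - k)) \<notin> \<F>"
proof -
  have "wt (arc xs i) + wt (arc xs (i + (card V - k))) = ratio"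
    using assms Fs_empty by (intro tight_pair tight) auto
  then show ?thesis
    by (rule wt_disjoint_eq(3)[OF big arc_pair_disjoint[OF assms(1)]])
qed

lemma disjoint_notin: "B' \<notin> \<F>" if "B \<in> \<F>" "B \<inter> B' = {}"
  using disj[OF that(1) _ that(2)] Fs_empty by auto

text \<open>Downward induction from \<open>k - 1\<close>, whose partner is the excluded arc
  \<open>card V - 1\<close>. Once arc \<open>j + 1\<close> is in \<open>\<F>\<close>, it excludes
  the partner of arc \<open>j\<close>, so arc \<open>j\<close> is in \<open>\<F>\<close>.\<close>

lemma arcs_after_boundary:
  assumes xs: "xs \<in> permutations_of_set V"
    and "arc xs 0 \<in> \<F>" "arc xs (card V - 1) \<notin> \<F>" "i < k"
  shows "arc xs i \<in> \<F>"
proof -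
  have "i \<le> k - 1"
    using assms(4) by simp
  then show ?thesis
  proof (induction i rule: inc_induct)
    case base
    then show ?case
      using pair_iff[OF xs assms(2), of "k - 1"] assms k_le by (cases "k = 1") auto
  next
    case (step j)
    show ?case
    proof (cases "j = 0")
      case False
      \<comment> \<open>The shift \<open>card V - k - 1\<close> is still at least \<open>k\<close>
        because \<open>2 * k < card V\<close>.\<close>
      have "arc xs (Suc j) \<inter> arc xs (Suc j + (card V - k - 1)) = {}"
        using big k_pos by (intro arc_disjoint[OF xs]) auto
      moreover have "Suc j + (card V - k - 1) = j + (card V - k)"
        using big by simp
      ultimately have "arc xs (j + (card V - k)) \<notin> \<F>"
        using step.IH disjoint_notin by metis
      then show ?thesis
        using pair_iff[OF xs assms(2), of j] False step.hyps by simp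
    qed (use assms in simp)
  qed
qed

lemma exists_boundary:
  obtains A x c where "insert x A \<in> \<F>" "insert c A \<notin> \<F>" "c \<in> V" "c \<notin> insert x A" "x \<notin> A"
proof -
  have "\<F> \<noteq> {}"
    using extremal choose_pos Fs_empty by auto
  then obtain L where L: "L \<in> \<F>"
    by blast
  then have "L \<subseteq> V" "card L = k"
    using F_sub by (auto simp: nsets_def)
  moreover define l r where "l = enum L" "r = enum (V - L)"
  ultimately have l: "set l = L" "distinct l" "set r = V - L" "distinct r"
    by (simp_all add: enum)
  then have xs: "l @ r \<in> permutations_of_set V" (is "?xs \<in> _")
    using \<open>L \<subseteq> V\<close> by (auto simp: permutations_of_set_def)
  have "length l = k"
    using l \<open>card L = k\<close> distinct_card by metis
  then have arc0: "arc ?xs 0 = L"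
    using l by (simp add: arc_def)
  have "arc ?xs k \<notin> \<F>"
    using arc_disjoint[OF xs, of k 0] k_le disjoint_notin[OF L] arc0 by simp
  moreover have "arc ?xs (card V) \<in> \<F>"
    using arc_periodic[OF xs, of 0] arc0 L by simp
  moreover have "k \<le> card V"
    using k_le by simp
  \<comment> \<open>Were non-membership inherited by successors from \<open>k\<close> on, the arc at
    \<open>card V\<close>, which is \<open>L\<close> again, would be outside
    \<open>\<F>\<close>.\<close>
  ultimately obtain i where i: "arc ?xs i \<notin> \<F>" "arc ?xs (Suc i) \<in> \<F>"
    using dec_induct[of k "card V" "\<lambda>i. arc ?xs i \<notin> \<F>"] by blast
  define ys where "ys = rotate i ?xs"
  have "ys \<in> permutations_of_set V"
    unfolding ys_def by (rule rotate_perm[OF xs])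
  then have ys: "set ys = V" "distinct ys" "length ys = card V"
    by (simp_all add: permutations_of_setD length_perm)
  then obtain c zs where c: "ys = c # zs"
    using card_V_pos by (cases ys) auto
  obtain k' where k': "k = Suc k'"
    using k_pos by (cases k) auto
  have len: "k' < length zs"
    using ys c k_le k' by simp
  have "take k (rotate 1 ys) = take k' zs @ [zs ! k']"
    using c len k' by (simp add: take_Suc_conv_app_nth)
  then have "insert (zs ! k') (set (take k' zs)) = arc ?xs (Suc i)"
    by (simp add: arc_def ys_def)
  moreover have "take k ys = c # take k' zs"
    using c k' by simp
  then have "insert c (set (take k' zs)) = arc ?xs i"
    by (simp add: arc_def flip: ys_def)
  moreover have "c \<notin> insert (zs ! k') (set (take k' zs))"
    using ys c len by (auto dest: in_set_takeD)
  moreover have "zs ! k' \<notin> set (take k' zs)"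
    using ys c len by (auto simp: in_set_conv_nth nth_eq_iff_index_eq)
  ultimately show thesis
    using i that[of "zs ! k'" "set (take k' zs)" c] ys c by auto
qed

text \<open>On a cycle whose arcs \<open>insert c A\<close>, \<open>insert x A\<close> are consecutive, the arcs in \<open>\<F>\<close> are
  exactly those through \<open>x\<close>; the rest of the cyclic order is free.\<close>

lemma boundary_star:
  assumes bd: "insert x A \<in> \<F>" "insert c A \<notin> \<F>" "c \<in> V" "c \<notin> insert x A" "x \<notin> A"
    and B: "B \<in> nsets V k" "x \<in> B" "c \<notin> B"
  shows "B \<in> \<F>"
proof -
  have AB: "insert x A \<subseteq> V" "finite A" "card (insert x A) = k" "B \<subseteq> V" "finite B" "card B = k"
    using bd(1) B F_sub by (auto simp: nsets_def)
  define a s t r where "a = enum (A - B)" "s = enum (A \<inter> B)" "t = enum (B - insert x A)"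
    "r = enum (V - B - insert c A)"
  then have l: "set a = A - B" "set s = A \<inter> B" "set t = B - insert x A"
    "set r = V - B - insert c A" "distinct a" "distinct s" "distinct t" "distinct r"
    using AB by (simp_all add: enum subset_iff)
  \<comment> \<open>Cyclically \<open>c\<close> precedes \<open>a\<close>, so arc
    \<open>card V - 1\<close> is \<open>insert c A\<close>, arc 0 is \<open>insert x A\<close>, and
    \<open>B\<close> is the arc starting right after \<open>a\<close>.\<close>
  define xs where "xs = a @ s @ x # t @ r @ [c]"
  have "set xs = V"
    unfolding xs_def using l(1-4) AB(1,4) bd(3) B(2) by auto
  moreover have "distinct xs"
    unfolding xs_def using l bd(4,5) B(2,3) by auto
  ultimately have xs: "xs \<in> permutations_of_set V"
    by (rule permutations_of_setI)
  have st: "set (a @ s @ [x]) = insert x A" "set (s @ x # t) = B"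
    using l(1-4) B(2) by auto
  moreover have "distinct (a @ s @ [x])" "distinct (s @ x # t)"
    using l bd(5) by auto
  ultimately have len: "length (a @ s @ [x]) = k" "length (s @ x # t) = k"
    using AB by (metis distinct_card)+
  have "take k xs = a @ s @ [x]"
    by (simp add: xs_def flip: len(1))
  then have arc0: "arc xs 0 = insert x A"
    using st by (simp add: arc_def)
  have "card V - 1 = length (a @ s @ x # t @ r)"
    using length_perm[OF xs] by (simp add: xs_def)
  then have "rotate (card V - 1) xs = [c] @ a @ s @ x # t @ r"
    using rotate_append[of "a @ s @ x # t @ r" "[c]"] unfolding xs_def by (simp only: append_assoc append_Cons)
  then have "take k (rotate (card V - 1) xs) = c # a @ s"
    by (simp flip: len(1))
  then have arcc: "arc xs (card V - 1) = insert c A"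
    using l by (auto simp: arc_def)
  have "rotate (length a) xs = s @ x # t @ r @ [c] @ a"
    using rotate_append[of a "s @ x # t @ r @ [c]"] by (simp add: xs_def)
  then have "take k (rotate (length a) xs) = s @ x # t"
    by (simp flip: len(2))
  then have "arc xs (length a) = B"
    using st by (simp add: arc_def)
  moreover have "length a < k"
    using len by simp
  ultimately show ?thesis
    using arcs_after_boundary[OF xs, of "length a"] bd arc0 arcc by simp
qed

text \<open>A member \<open>D\<close> missing \<open>x\<close> would be disjoint from some
  \<open>k\<close>-set through \<open>x\<close> that avoids \<open>c\<close>, and
  \<open>boundary_star\<close> puts that set into \<open>\<F>\<close>.\<close>

lemma subset_star: "\<exists>x\<in>V. \<F> \<subseteq> {B \<in> nsets V k. x \<in> B}"
proof -
  obtain A x c where bd: "insert x A \<in> \<F>" "insert c A \<notin> \<F>" "c \<in> V" "c \<notin> insert x A" "x \<notin> A"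
    by (rule exists_boundary)
  have x: "x \<in> V"
    using bd(1) F_sub by (auto simp: nsets_def)
  have "x \<in> D" if D: "D \<in> \<F>" for D
  proof (rule ccontr)
    assume "x \<notin> D"
    have "D \<subseteq> V" "finite D" "card D = k"
      using D F_sub by (auto simp: nsets_def)
    moreover have "card (V - (D \<union> {c, x})) \<ge> card V - card (D \<union> {c, x})"
      using \<open>finite D\<close> by (intro diff_card_le_card_Diff) auto
    moreover have "card (D \<union> {c, x}) \<le> k + 2"
      using card_Un_le[of D "{c, x}"] \<open>card D = k\<close> bd(4) by (auto simp: card_insert_if split: if_splits)
    \<comment> \<open>From \<open>card V \<ge> 2 * k + 1\<close>, removing at most
      \<open>k + 2\<close> elements leaves at least \<open>k - 1\<close>.\<close>
    ultimately have "k - 1 \<le> card (V - (D \<union> {c, x}))"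
      using big by linarith
    then obtain U where U: "U \<subseteq> V - (D \<union> {c, x})" "card U = k - 1" "finite U"
      by (metis obtain_subset_with_card_n)
    then have "insert x U \<in> nsets V k" "c \<notin> insert x U"
      using x k_pos bd(4) by (auto simp: nsets_def card_insert_if)
    then have "insert x U \<in> \<F>"
      using boundary_star[OF bd] by blast
    moreover have "D \<inter> insert x U = {}"
      using U \<open>x \<notin> D\<close> by auto
    ultimately show False
      using disjoint_notin[OF D] by blast
  qed
  then show ?thesis
    using x F_sub by blast
qed

text \<open>Two sets of the star share \<open>x\<close>, so the star satisfies the hypotheses with
  \<open>{}\<close> as \<open>\<F>s\<close>. The bound for it, against equality for
  \<open>\<F>\<close>, shows that it is no larger than its subset \<open>\<F>\<close>.\<close>

lemma eq_star: "\<exists>x\<in>V. \<F> = {B \<in> nsets V k. x \<in> B}"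
proof -
  obtain x where x: "x \<in> V" and sub: "\<F> \<subseteq> {B \<in> nsets V k. x \<in> B}" (is "_ \<subseteq> ?S")
    using subset_star by blast
  interpret star: disjointness_closed V k ?S "{}"
    using finV k_pos k_le by unfold_locales auto
  have "ratio * real (card ?S) \<le> ratio * real (card \<F>)"
    using star.weighted_bound extremal Fs_empty by simp
  then have "card ?S \<le> card \<F>"
    using ratio_ge by simp
  moreover have "finite ?S"
    using finite_imp_finite_nsets[OF finV] by simp
  ultimately have "\<F> = ?S"
    using sub by (intro card_seteq) auto
  then show ?thesis
    using x by blast
qed

end

end

theorem theorem3:
  fixes n k :: nat and \<F> \<F>s :: "nat set set"
  assumes "2 \<le> k" and "2 * k \<le> n"
    and "\<F>s \<subseteq> \<F>" and "\<F> \<subseteq> nsets {1..n} k"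
    and "\<And>B B'. B \<in> \<F> \<Longrightarrow> B' \<in> \<F> \<Longrightarrow> B \<inter> B' = {} \<Longrightarrow> B \<in> \<F>s \<and> B' \<in> \<F>s"
  shows "real (card \<F>s) + real n / real k * real (card (\<F> - \<F>s)) \<le> real (n choose k)
    \<and> (2 * k < n \<longrightarrow>
         real (card \<F>s) + real n / real k * real (card (\<F> - \<F>s)) = real (n choose k) \<longrightarrow>
         (\<F>s = \<F> \<and> \<F> = nsets {1..n} k)
         \<or> (\<F>s = {} \<and> (\<exists>x\<in>{1..n}. \<F> = {B \<in> nsets {1..n} k. x \<in> B})))"
proof -
  interpret disjointness_closed "{1..n}" k \<F> \<F>s
    using assms by unfold_locales auto
  have ratio: "ratio = real n / real k"
    unfolding ratio_def by simp
  have "(\<F>s = \<F> \<and> \<F> = nsets {1..n} k) \<or> (\<F>s = {} \<and> (\<exists>x\<in>{1..n}. \<F> = {B \<in> nsets {1..n} k. x \<in> B}))"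
    if "2 * k < n" "real (card \<F>s) + real n / real k * real (card (\<F> - \<F>s)) = real (n choose k)"
  proof -
    interpret extremal_family "{1..n}" k \<F> \<F>s
      by unfold_locales (use that in \<open>simp_all add: ratio del: One_nat_def\<close>)
    show ?thesis
      using eq_star Fs_nonempty_imp_all Fs_sub F_sub by blast
  qed
  then show ?thesis
    using weighted_bound unfolding ratio by simp
qed

end
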